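(* Let $f,g$ be complex entire functions of finite order satisfying $f^2-(z^2-1)g^2=1$. Then $f$ and $g$ are holonomic.
   Context: An entire function $f$ has finite order if there is $A\ge0$ with $\log\max\{|f(z)|:|z|\le r\}=O_f(r^A)$ for all $r>1$. A function holomorphic near $z=0$ is holonomic if its power series expansion $F$ at $0$ satisfies $P_kF^{(k)}+\dots+P_1F^{(1)}+P_0F=0$ for some integer $k\ge1$ and polynomials $P_0,\dots,P_k\in\mathbb{C}[z]$ with $P_k\ne0$. *)

theory Defs
  imports
    "HOL-Complex_Analysis.Complex_Analysis"
    "HOL-Computational_Algebra.Computational_Algebra"
begin

text \<open>
  For continuous \<open>f\<close> the supremum below is attained, i.e. it is the maximum of \<open>\<bar>f\<bar>\<close> on the closed
  disc of radius \<open>r\<close>. If \<open>f\<close> is identically zero, then \<open>ln 0 = 0\<close> makes \<open>f\<close> have finite order,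
  in accordance with the usual reading \<open>log 0 = -\<infinity>\<close> as satisfying every upper bound.
\<close>

definition finite_order :: "(complex \<Rightarrow> complex) \<Rightarrow> bool" where
  "finite_order f \<longleftrightarrow>
     (\<exists>A::real. A \<ge> 0 \<and> (\<exists>C::real. \<forall>r>1.
        \<bar>ln (SUP z\<in>cball 0 r. norm (f z))\<bar> \<le> C * r powr A))"

definition holonomic :: "(complex \<Rightarrow> complex) \<Rightarrow> bool" where
  "holonomic f \<longleftrightarrow>
     f analytic_on {0} \<and>
     (\<exists>(k::nat) (P :: nat \<Rightarrow> complex poly). k \<ge> 1 \<and> P k \<noteq> 0 \<and>
        (\<Sum>i\<le>k. fps_of_poly (P i) * (fps_deriv ^^ i) (fps_expansion f 0)) = 0)"

end

theory Submission
  imports Defs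
begin

text \<open>
  Put \<open>p = f (z g + (z\<^sup>2 - 1) g') - (z\<^sup>2 - 1) f' g\<close>. Differentiating the Pell equation gives
  \<open>f' = p g\<close> and \<open>z g + (z\<^sup>2 - 1) g' = p f\<close>. Wherever \<open>s = \<surd>(z\<^sup>2 - 1)\<close> can be chosen
  holomorphically, \<open>F = f + s g\<close> satisfies \<open>1 / F = f - s g\<close> and \<open>F' / F = p / s\<close>. Finite order
  bounds both \<open>log \<bar>F\<bar>\<close> and \<open>- log \<bar>F\<bar>\<close> by a power of \<open>\<bar>z\<bar>\<close>, so the logarithmic
  derivative, and with it \<open>p\<close>, has polynomial growth; by Liouville \<open>p\<close> is a polynomial. The first-order
  linear system for \<open>f\<close> and \<open>g\<close> then yields a second-order equation for each of them.
\<close>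

section \<open>Growth of entire functions of finite order\<close>

text \<open>Since \<open>r\<close> > 1, the real exponent may be rounded up to a natural number and
  the constant raised to at least 0. Bounds for two functions can then be merged by taking
  maxima.\<close>

lemma finite_order_bound:
  assumes "f holomorphic_on UNIV" and "finite_order f"
  obtains C :: real and n :: nat
  where "C \<ge> 0" and "\<And>r z. r > 1 \<Longrightarrow> norm z \<le> r \<Longrightarrow> norm (f z) \<le> exp (C * r ^ n)"
proof -
  from assms(2) obtain A C :: real where A: "A \<ge> 0"
    and bd: "\<And>r. r > 1 \<Longrightarrow> \<bar>ln (SUP z\<in>cball 0 r. norm (f z))\<bar> \<le> C * r powr A"
    unfolding finite_order_def by blast
  define n where "n = nat \<lceil>A\<rceil>"
  have n: "A \<le> real n"
    unfolding n_def by linarith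
  have "norm (f z) \<le> exp (max C 0 * r ^ n)" if r: "r > 1" and z: "norm z \<le> r" for r z
  proof -
    define S where "S = (SUP z\<in>cball 0 r. norm (f z))"
    have "continuous_on (cball 0 r) (\<lambda>z. norm (f z))"
      using assms(1) holomorphic_on_imp_continuous_on holomorphic_on_subset
      by (intro continuous_on_norm) blast
    then have "compact ((\<lambda>z. norm (f z)) ` cball 0 r)"
      by (intro compact_continuous_image) auto
    then have "bdd_above ((\<lambda>z. norm (f z)) ` cball 0 r)"
      by (intro bounded_imp_bdd_above compact_imp_bounded)
    then have zS: "norm (f z) \<le> S"
      unfolding S_def using z by (intro cSUP_upper) auto
    show ?thesis
    proof (cases "S > 0")
      case True
      have "ln S \<le> C * r powr A"
        using bd[OF r] unfolding S_def by linarith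
      also have "\<dots> \<le> max C 0 * r powr real n"
        using n r by (intro mult_mono powr_mono) auto
      also have "\<dots> = max C 0 * r ^ n"
        using r by (simp add: powr_realpow)
      finally have "S \<le> exp (max C 0 * r ^ n)"
        using True by (metis exp_le_cancel_iff exp_ln)
      with zS show ?thesis by linarith
    next
      \<comment> \<open>Here \<open>ln S\<close> carries no information, but
        \<open>norm (f z)\<close> \<le> \<open>S\<close> \<le> 0 makes the bound trivial.\<close>
      case False
      with zS show ?thesis
        by (smt (verit) exp_gt_zero)
    qed
  qed
  then show ?thesis
    using that[of "max C 0" n] by auto
qed

section \<open>Estimate of a logarithmic derivative\<close>

text \<open>A zero-free \<open>F\<close> on a disc is \<open>exp H\<close> with \<open>Re H\<close>
  between \<open>- M\<close> and \<open>M\<close>, and \<open>F' = F H'\<close>. Cauchy's inequality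
  for \<open>exp (H / M)\<close> then controls \<open>H'\<close>. The factor \<open>exp 2\<close> is
  the quotient of the bounds \<open>exp 1\<close> and \<open>exp (- 1)\<close> for the modulus of
  that function.\<close>

lemma norm_deriv_le_of_norm_between_exp:
  fixes F :: "complex \<Rightarrow> complex"
  assumes hol: "F holomorphic_on ball z R" and r: "0 < r" "r < R" and M: "M > 0"
    and lower: "\<And>w. w \<in> ball z R \<Longrightarrow> exp (- M) \<le> norm (F w)"
    and upper: "\<And>w. w \<in> ball z R \<Longrightarrow> norm (F w) \<le> exp M"
  shows "norm (deriv F z) \<le> norm (F z) * (M * exp 2 / r)"
proof -
  have nz: "F w \<noteq> 0" if "w \<in> ball z R" for w
    using lower[OF that] by (metis exp_gt_zero norm_zero not_less)
  obtain H where H: "H holomorphic_on ball z R" and FH: "\<And>w. w \<in> ball z R \<Longrightarrow> F w = exp (H w)"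
    by (rule contractible_imp_holomorphic_log[OF hol convex_imp_contractible[OF convex_ball] nz])
      blast+
  have Re_H: "\<bar>Re (H w)\<bar> \<le> M" if "w \<in> ball z R" for w
    using lower[OF that] upper[OF that] FH[OF that] by (simp add: abs_le_iff)
  \<comment> \<open>Dividing by \<open>M\<close> makes the modulus of \<open>K\<close> bounded
    independently of \<open>M\<close>, so the estimate for \<open>H'\<close> is linear in
    \<open>M\<close> instead of exponential.\<close>
  define K where "K = (\<lambda>w. exp (H w / of_real M))"
  have K: "K holomorphic_on ball z R"
    unfolding K_def using H M by (intro holomorphic_intros) auto
  have norm_K: "norm (K w) = exp (Re (H w) / M)" for w
    by (simp add: K_def)
  have zin: "z \<in> ball z R"
    using r by simp
  have "norm ((deriv ^^ 1) K z) \<le> fact 1 * exp 1 / r ^ 1"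
  proof (rule Cauchy_inequality)
    show "K holomorphic_on ball z r"
      using K r by (auto intro: holomorphic_on_subset)
    have "cball z r \<subseteq> ball z R"
      using r by auto
    then show "continuous_on (cball z r) K"
      using K holomorphic_on_imp_continuous_on holomorphic_on_subset by blast
    fix w assume "norm (z - w) = r"
    then have "w \<in> ball z R"
      using r by (simp add: dist_norm)
    then have "Re (H w) / M \<le> 1"
      using Re_H[of w] M by (simp add: abs_le_iff)
    then show "norm (K w) \<le> exp 1"
      by (simp add: norm_K)
  qed (use r in auto)
  then have dK: "norm (deriv K z) \<le> exp 1 / r"
    by simp
  have dH: "(H has_field_derivative deriv H z) (at z)"
    using H zin by (intro holomorphic_derivI[OF H]) auto
  have "(K has_field_derivative K z * (deriv H z / of_real M)) (at z)"
    unfolding K_def using dH M by (auto intro!: derivative_eq_intros)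
  then have "deriv K z = K z * (deriv H z / of_real M)"
    by (rule DERIV_imp_deriv)
  with dK M have "norm (K z) * (norm (deriv H z) / M) \<le> exp 1 / r"
    by (simp add: norm_mult norm_divide)
  moreover have "exp (- 1) \<le> norm (K z)"
  proof -
    have "- 1 \<le> Re (H z) / M"
      using Re_H[OF zin] M by (simp add: abs_le_iff field_simps)
    then show ?thesis
      by (simp add: norm_K)
  qed
  ultimately have "exp (- 1) * (norm (deriv H z) / M) \<le> exp 1 / r"
    using M by (smt (verit) divide_nonneg_pos mult_right_mono norm_ge_zero)
  then have "exp 1 * (exp (- 1) * (norm (deriv H z) / M)) \<le> exp 1 * (exp 1 / r)"
    by (intro mult_left_mono) auto
  then have "norm (deriv H z) / M \<le> exp 2 / r"
    by (simp add: mult.assoc[symmetric] flip: exp_add)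
  then have H': "norm (deriv H z) \<le> M * exp 2 / r"
    using M by (simp add: field_simps)
  have "((\<lambda>w. exp (H w)) has_field_derivative exp (H z) * deriv H z) (at z)"
    using dH by (auto intro!: derivative_eq_intros)
  then have "(F has_field_derivative exp (H z) * deriv H z) (at z)"
    by (rule has_field_derivative_transform_within_open[OF _ open_ball zin]) (simp add: FH)
  then have "deriv F z = F z * deriv H z"
    using FH[OF zin] by (simp add: DERIV_imp_deriv)
  then show ?thesis
    using mult_left_mono[OF H' norm_ge_zero, of "F z"] by (simp add: norm_mult)
qed

section \<open>Polynomial growth of the cofactor \<open>p\<close>\<close>

text \<open>The hypotheses on \<open>p\<close> say \<open>s F' = p F\<close> for \<open>F = f + s g\<close>, \<open>s\<^sup>2 = z\<^sup>2 - 1\<close>.\<close>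

lemma pell_cofactor_polynomial:
  fixes f g p :: "complex \<Rightarrow> complex"
  assumes f: "f holomorphic_on UNIV" and g: "g holomorphic_on UNIV" and p: "p holomorphic_on UNIV"
    and order: "finite_order f" "finite_order g"
    and pell: "\<And>z. f z ^ 2 - (z ^ 2 - 1) * g z ^ 2 = 1"
    and df: "\<And>z. deriv f z = p z * g z"
    and dg: "\<And>z. z * g z + (z ^ 2 - 1) * deriv g z = p z * f z"
  obtains P where "p = poly P"
proof -
  obtain C1 n1 where C1: "C1 \<ge> 0" and
    f_bd: "\<And>r z. r > 1 \<Longrightarrow> norm z \<le> r \<Longrightarrow> norm (f z) \<le> exp (C1 * r ^ n1)"
    using finite_order_bound[OF f order(1)] by blast
  obtain C2 n2 where C2: "C2 \<ge> 0" and
    g_bd: "\<And>r z. r > 1 \<Longrightarrow> norm z \<le> r \<Longrightarrow> norm (g z) \<le> exp (C2 * r ^ n2)"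
    using finite_order_bound[OF g order(2)] by blast
  define C where "C = max C1 C2"
  define n where "n = max n1 n2"
  have C: "C \<ge> 0" "C1 \<le> C" "C2 \<le> C" and n: "n1 \<le> n" "n2 \<le> n"
    using C1 by (auto simp: C_def n_def)
  \<comment> \<open>\<open>B\<close> collects the coefficients of the final estimate after
    \<open>norm z ^ (n + 1)\<close> and \<open>norm z ^ 2\<close> are both raised to
    \<open>norm z ^ (n + 2)\<close>.\<close>
  define B where "B = 4 * exp 2 * (C * 2 ^ n + 2)"
  \<comment> \<open>For \<open>norm z\<close> \<ge> 3 the unit disc around \<open>z\<close> avoids 1
    and -1, so a branch of the square root exists there. A local branch suffices, because the
    resulting bound on \<open>p z\<close> does not depend on it.\<close>
  have "norm (p z) \<le> B * norm z ^ (n + 2)" if z: "3 \<le> norm z" for z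
  proof -
    \<comment> \<open>\<open>\<rho>\<close> bounds both \<open>norm w\<close> and
      \<open>norm (s w)\<close> on the disc. The extra summand \<open>\<rho>\<close> in
      \<open>M\<close> absorbs the factor 1 + \<open>\<rho>\<close> \<le> \<open>exp \<rho>\<close>
      that arises from adding \<open>f\<close> and \<open>s g\<close>.\<close>
    define \<rho> where "\<rho> = 2 * norm z"
    define M where "M = C * \<rho> ^ n + \<rho>"
    have \<rho>: "\<rho> > 1" using z by (simp add: \<rho>_def)
    have M: "M > 0"
      using C \<rho> by (simp add: M_def add_nonneg_pos)
    have w_norm: "1 < norm w" "norm w + 1 \<le> \<rho>" if "w \<in> ball z 1" for w
    proof -
      have "\<bar>norm z - norm w\<bar> < 1"
        using that norm_triangle_ineq3[of z w] by (simp add: dist_norm)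
      then show "1 < norm w" "norm w + 1 \<le> \<rho>"
        using z by (auto simp: \<rho>_def)
    qed
    have nz: "w ^ 2 - 1 \<noteq> 0" if "w \<in> ball z 1" for w
      using w_norm(1)[OF that] by (auto simp: power2_eq_1_iff)
    have "(\<lambda>w. w ^ 2 - 1) holomorphic_on ball z 1"
      by (intro holomorphic_intros)
    then obtain s where s: "s holomorphic_on ball z 1"
      and s2: "\<And>w. w \<in> ball z 1 \<Longrightarrow> w ^ 2 - 1 = s w ^ 2"
      by (rule contractible_imp_holomorphic_sqrt[OF _ convex_imp_contractible[OF convex_ball] nz])
        blast+
    have s_le: "norm (s w) \<le> \<rho>" if w: "w \<in> ball z 1" for w
    proof -
      have "norm (s w) ^ 2 = norm (w ^ 2 - 1)"
        by (simp add: s2[OF w] norm_power)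
      also have "\<dots> \<le> norm w ^ 2 + 1"
        using norm_triangle_ineq4[of "w ^ 2" 1] by (simp add: norm_power)
      also have "\<dots> \<le> (norm w + 1) ^ 2"
        by (simp add: power2_eq_square algebra_simps)
      finally have "norm (s w) \<le> norm w + 1"
        by (rule power2_le_imp_le) simp
      then show ?thesis
        using w_norm(2)[OF w] by linarith
    qed
    define F where "F = (\<lambda>w. f w + s w * g w)"
    define G where "G = (\<lambda>w. f w - s w * g w)"
    have hol: "F holomorphic_on ball z 1"
      unfolding F_def
      using f g s by (auto intro!: holomorphic_intros intro: holomorphic_on_subset)
    have FG: "F w * G w = 1" if w: "w \<in> ball z 1" for w
      using pell[of w] unfolding s2[OF w] F_def G_def by algebra
    have sum_bd: "norm (f w) + norm (s w * g w) \<le> exp M" if w: "w \<in> ball z 1" for w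
    proof -
      have w': "norm w \<le> \<rho>"
        using w_norm(2)[OF w] by linarith
      have "C1 * \<rho> ^ n1 \<le> C * \<rho> ^ n" "C2 * \<rho> ^ n2 \<le> C * \<rho> ^ n"
        using C n \<rho> by (auto intro!: mult_mono power_increasing)
      then have fw: "norm (f w) \<le> exp (C * \<rho> ^ n)" and gw: "norm (g w) \<le> exp (C * \<rho> ^ n)"
        using f_bd[OF \<rho> w'] g_bd[OF \<rho> w'] by (meson exp_le_cancel_iff order_trans)+
      have "norm (s w * g w) \<le> \<rho> * exp (C * \<rho> ^ n)"
        unfolding norm_mult using s_le[OF w] gw \<rho> by (intro mult_mono) auto
      with fw have "norm (f w) + norm (s w * g w) \<le> exp (C * \<rho> ^ n) * (1 + \<rho>)"
        by (simp add: algebra_simps)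
      also have "\<dots> \<le> exp (C * \<rho> ^ n) * exp \<rho>"
        by (intro mult_left_mono) auto
      finally show ?thesis
        by (simp add: M_def exp_add)
    qed
    have upper: "norm (F w) \<le> exp M" and G_upper: "norm (G w) \<le> exp M" if "w \<in> ball z 1" for w
      using sum_bd[OF that] norm_triangle_ineq[of "f w" "s w * g w"]
        norm_triangle_ineq4[of "f w" "s w * g w"] by (auto simp: F_def G_def)
    \<comment> \<open>\<open>G\<close> is the reciprocal of \<open>F\<close>, so its upper bound is
      a lower bound for \<open>F\<close>.\<close>
    have lower: "exp (- M) \<le> norm (F w)" if w: "w \<in> ball z 1" for w
    proof -
      have "1 = norm (F w) * norm (G w)"
        using FG[OF w] by (metis norm_mult norm_one)
      also have "\<dots> \<le> norm (F w) * exp M"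
        using G_upper[OF w] by (intro mult_left_mono) auto
      finally show ?thesis
        by (simp add: exp_minus field_simps)
    qed
    have zin: "z \<in> ball z 1" by simp
    have F': "norm (deriv F z) \<le> norm (F z) * (M * exp 2 / (1 / 2))"
      by (rule norm_deriv_le_of_norm_between_exp[OF hol _ _ M lower upper]) auto
    have ds: "(s has_field_derivative deriv s z) (at z)"
      using zin by (intro holomorphic_derivI[OF s]) auto
    have "((\<lambda>w. s w ^ 2) has_field_derivative 2 * s z * deriv s z) (at z)"
      using ds by (auto intro!: derivative_eq_intros)
    moreover have "((\<lambda>w. s w ^ 2) has_field_derivative 2 * z) (at z)"
    proof (rule has_field_derivative_transform_within_open[OF _ open_ball zin])
      show "((\<lambda>w. w ^ 2 - 1) has_field_derivative 2 * z) (at z)"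
        by (auto intro!: derivative_eq_intros)
    qed (rule s2)
    ultimately have ss': "s z * deriv s z = z"
      using DERIV_unique by fastforce
    have dfz: "(f has_field_derivative deriv f z) (at z)"
      and dgz: "(g has_field_derivative deriv g z) (at z)"
      using f g by (auto intro: holomorphic_derivI)
    have "(F has_field_derivative deriv f z + (deriv s z * g z + s z * deriv g z)) (at z)"
      unfolding F_def using dfz dgz ds by (auto intro!: derivative_eq_intros)
    then have "deriv F z = deriv f z + (deriv s z * g z + s z * deriv g z)"
      by (rule DERIV_imp_deriv)
    \<comment> \<open>Multiplication by \<open>s\<close> turns \<open>s'\<close> into
      \<open>z\<close> by \<open>ss'\<close> and makes the coefficient of \<open>g'\<close> equal to
      \<open>z^2 - 1\<close>, which is the form in which \<open>dg\<close> applies.\<close>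
    then have "s z * deriv F z
        = s z * deriv f z + ((s z * deriv s z) * g z + s z ^ 2 * deriv g z)"
      by (simp add: algebra_simps power2_eq_square)
    also have "\<dots> = s z * (p z * g z) + p z * f z"
      using dg[of z] by (simp only: ss' s2[OF zin, symmetric] df)
    also have "\<dots> = p z * F z"
      by (simp add: F_def algebra_simps)
    finally have "norm (p z) * norm (F z) = norm (s z) * norm (deriv F z)"
      by (metis norm_mult)
    also have "\<dots> \<le> \<rho> * (norm (F z) * (M * exp 2 / (1 / 2)))"
      using s_le[OF zin] F' \<rho> by (intro mult_mono) auto
    finally have "norm (p z) * norm (F z) \<le> (2 * exp 2 * \<rho> * M) * norm (F z)"
      by (simp add: algebra_simps)
    moreover have "norm (F z) > 0"
      using FG[OF zin] by auto
    ultimately have "norm (p z) \<le> 2 * exp 2 * \<rho> * M"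
      by (rule mult_right_le_imp_le)
    also have "\<dots> = 4 * exp 2 * (C * 2 ^ n * norm z ^ (n + 1) + 2 * norm z ^ 2)"
      by (simp add: \<rho>_def M_def algebra_simps power2_eq_square power_mult_distrib)
    also have "\<dots> \<le> 4 * exp 2 * (C * 2 ^ n * norm z ^ (n + 2) + 2 * norm z ^ (n + 2))"
      using z C by (intro mult_left_mono add_mono power_increasing) auto
    also have "\<dots> = B * norm z ^ (n + 2)"
      by (simp add: B_def algebra_simps)
    finally show ?thesis .
  qed
  then have "p z = (\<Sum>k\<le>n + 2. (deriv ^^ k) p 0 / fact k * z ^ k)" for z
    by (rule Liouville_polynomial[OF p])
  then have "p = poly (\<Sum>k\<le>n + 2. monom ((deriv ^^ k) p 0 / fact k) k)"
    by (simp add: fun_eq_iff poly_sum poly_monom)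
  then show ?thesis by (rule that)
qed

section \<open>Power series and second-order equations\<close>

lemma has_fps_expansion_poly:
  fixes P :: "complex poly"
  shows "poly P has_fps_expansion fps_of_poly P"
proof (induction P)
  case 0
  then show ?case by simp
next
  case (pCons a P)
  have "(\<lambda>x. a + x * poly P x) has_fps_expansion fps_const a + fps_X * fps_of_poly P"
    by (intro fps_expansion_intros pCons.IH)
  then show ?case
    by (simp add: fps_of_poly_pCons algebra_simps)
qed

lemma entire_has_fps_expansion:
  assumes "f holomorphic_on UNIV"
  shows "f has_fps_expansion fps_expansion f 0"
  using assms by (intro has_fps_expansion_fps_expansion[of UNIV]) auto

text \<open>Takes \<open>k = 2\<close> in the definition, so that one explicit equation with nonzero
  leading coefficient suffices for each function.\<close>

lemma holonomic_of_order_two: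
  assumes "f holomorphic_on UNIV" and "P2 \<noteq> 0"
    and "F = fps_expansion f 0"
    and "fps_of_poly P0 * F + fps_of_poly P1 * fps_deriv F
      + fps_of_poly P2 * fps_deriv (fps_deriv F) = 0"
  shows "holonomic f"
  unfolding holonomic_def
proof (intro conjI exI)
  show "f analytic_on {0}"
    using assms(1) by (auto simp: analytic_on_holomorphic)
  let ?P = "\<lambda>i::nat. if i = 0 then P0 else if i = 1 then P1 else P2"
  show "1 \<le> (2::nat)" "?P 2 \<noteq> 0"
    using assms(2) by auto
  show "(\<Sum>i\<le>2. fps_of_poly (?P i) * (fps_deriv ^^ i) (fps_expansion f 0)) = 0"
    using assms(3,4) by (simp add: numeral_2_eq_2)
qed

section \<open>The linear system for \<open>f\<close> and \<open>g\<close> and its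
  elimination\<close>

theorem theorem1p3:
  fixes f g :: "complex \<Rightarrow> complex"
  assumes "f holomorphic_on UNIV" and "g holomorphic_on UNIV"
    and "finite_order f" and "finite_order g"
    and "\<forall>z. f z ^ 2 - (z ^ 2 - 1) * g z ^ 2 = 1"
  shows "holonomic f \<and> holonomic g"
proof -
  note f = assms(1) and g = assms(2)
  have pell: "f z ^ 2 - (z ^ 2 - 1) * g z ^ 2 = 1" for z
    using assms(5) by blast
  \<comment> \<open>Where a branch \<open>s\<close> exists, \<open>q\<close> is \<open>s\<close>
    times the derivative of \<open>s g\<close>. Both \<open>q\<close> and \<open>p\<close> are
    formed without division and hence are entire.\<close>
  define q where "q = (\<lambda>z. z * g z + (z ^ 2 - 1) * deriv g z)"
  define p where "p = (\<lambda>z. f z * q z - (z ^ 2 - 1) * deriv f z * g z)"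
  have p: "p holomorphic_on UNIV"
    unfolding p_def q_def using f g by (auto intro!: holomorphic_intros)
  have rel: "f z * deriv f z = g z * q z" for z
  proof -
    have d: "(f has_field_derivative deriv f z) (at z)" "(g has_field_derivative deriv g z) (at z)"
      using f g by (auto intro: holomorphic_derivI)
    have "((\<lambda>z. f z ^ 2 - (z ^ 2 - 1) * g z ^ 2) has_field_derivative
        2 * f z * deriv f z - (2 * z * g z ^ 2 + (z ^ 2 - 1) * (2 * g z * deriv g z))) (at z)"
      using d by (auto intro!: derivative_eq_intros)
    moreover have "(\<lambda>z. f z ^ 2 - (z ^ 2 - 1) * g z ^ 2) = (\<lambda>z. 1)"
      using pell by auto
    ultimately have
      "((\<lambda>z. 1) has_field_derivative
        2 * f z * deriv f z - (2 * z * g z ^ 2 + (z ^ 2 - 1) * (2 * g z * deriv g z))) (at z)"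
      by simp
    then have "2 * f z * deriv f z - (2 * z * g z ^ 2 + (z ^ 2 - 1) * (2 * g z * deriv g z)) = 0"
      using DERIV_unique DERIV_const by blast
    then have "2 * (f z * deriv f z) = 2 * (g z * q z)"
      by (simp add: q_def algebra_simps power2_eq_square)
    then show ?thesis by simp
  qed
  \<comment> \<open>Replacing \<open>g q\<close> by \<open>f f'\<close> in \<open>p g\<close> leaves
    \<open>f'\<close> times the left side of the Pell equation. In the same way, \<open>p f\<close>
    reduces to \<open>q\<close>.\<close>
  have df: "deriv f z = p z * g z" for z
    using rel[of z] pell[of z] unfolding p_def by algebra
  have dg: "q z = p z * f z" for z
    using rel[of z] pell[of z] unfolding p_def by algebra
  obtain P where P: "p = poly P"
    using pell_cofactor_polynomial[OF f g p assms(3,4) pell df] dg unfolding q_def by blast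
  define F where "F = fps_expansion f 0"
  define G where "G = fps_expansion g 0"
  define Q where "Q = fps_of_poly P"
  define W :: "complex poly" where "W = [:- 1, 0, 1:]"
  have W: "fps_of_poly W = fps_X ^ 2 - 1"
    by (simp add: W_def fps_of_poly_pCons power2_eq_square algebra_simps)
  have FE: "f has_fps_expansion F" and GE: "g has_fps_expansion G"
    using f g by (simp_all add: F_def G_def entire_has_fps_expansion)
  have QE: "p has_fps_expansion Q"
    by (simp add: P Q_def has_fps_expansion_poly)
  have "(\<lambda>z. p z * g z) has_fps_expansion Q * G"
    by (intro fps_expansion_intros QE GE)
  then have "deriv f has_fps_expansion Q * G"
    by (simp add: df[abs_def])
  then have F': "fps_deriv F = Q * G"
    using has_fps_expansion_deriv[OF FE] fps_expansion_unique_complex by blast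
  have "q has_fps_expansion fps_X * G + (fps_X ^ 2 - 1) * fps_deriv G"
    unfolding q_def by (intro fps_expansion_intros GE)
  moreover have "q has_fps_expansion Q * F"
    unfolding dg[abs_def] by (intro fps_expansion_intros QE FE)
  ultimately have G': "fps_X * G + (fps_X ^ 2 - 1) * fps_deriv G = Q * F"
    using fps_expansion_unique_complex by blast
  have F'': "fps_deriv (fps_deriv F) = fps_deriv Q * G + Q * fps_deriv G"
    by (simp add: F' algebra_simps)
  have G'': "G + 3 * fps_X * fps_deriv G + (fps_X ^ 2 - 1) * fps_deriv (fps_deriv G)
      = fps_deriv Q * F + Q * fps_deriv F"
    using arg_cong[OF G', of fps_deriv] by (simp add: algebra_simps power2_eq_square)
  have dQ: "fps_of_poly (pderiv P) = fps_deriv Q"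
    by (simp add: Q_def fps_of_poly_pderiv)
  have X: "fps_of_poly [:0, 1:] = (fps_X :: complex fps)" by simp
  have "W \<noteq> 0"
    by (simp add: W_def)
  \<comment> \<open>The equations obtained by elimination have leading coefficient
    \<open>P * W\<close>, so \<open>P = 0\<close> is treated separately: then
    \<open>F'' = 0\<close>, and \<open>G''\<close> is already an equation for \<open>G\<close>
    alone.\<close>
  show ?thesis
  proof (cases "P = 0")
    case True
    then have "Q = 0"
      by (simp add: Q_def)
    have "holonomic f"
      by (rule holonomic_of_order_two[OF f, of 1 F 0 0]) (simp_all add: F_def[symmetric] F' \<open>Q = 0\<close>)
    moreover have "holonomic g"
      by (rule holonomic_of_order_two[OF g \<open>W \<noteq> 0\<close> G_def, of 1 "[:0, 3:]"])
        (use G'' in \<open>simp add: \<open>Q = 0\<close> W fps_of_poly_pCons algebra_simps numeral_fps_const\<close>)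
    ultimately show ?thesis ..
  next
    case False
    then have "P * W \<noteq> 0"
      using \<open>W \<noteq> 0\<close> by simp
    have "holonomic f"
    proof (rule holonomic_of_order_two[OF f \<open>P * W \<noteq> 0\<close> F_def])
      \<comment> \<open>Multiply \<open>F''\<close> by \<open>Q W\<close>, then replace
        \<open>Q G\<close> by \<open>F'\<close> and \<open>W G'\<close> by \<open>Q F - X G\<close>;
        the remaining \<open>Q^2 X G\<close> is \<open>Q X F'\<close>.\<close>
      show "fps_of_poly (- (P ^ 3)) * F + fps_of_poly ([:0, 1:] * P - W * pderiv P) * fps_deriv F
          + fps_of_poly (P * W) * fps_deriv (fps_deriv F) = 0"
        unfolding fps_of_poly_mult fps_of_poly_diff fps_of_poly_uminus fps_of_poly_power
          dQ W X Q_def[symmetric]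
        using F' F'' G' by algebra
    qed
    moreover have "holonomic g"
    proof (rule holonomic_of_order_two[OF g \<open>P * W \<noteq> 0\<close> G_def])
      \<comment> \<open>Multiply \<open>G''\<close> by \<open>Q\<close>, then replace
        \<open>Q F\<close> by \<open>X G + W G'\<close> and \<open>F'\<close> by
        \<open>Q G\<close>.\<close>
      show "fps_of_poly (P - pderiv P * [:0, 1:] - P ^ 3) * G
          + fps_of_poly (3 * P * [:0, 1:] - pderiv P * W) * fps_deriv G
          + fps_of_poly (P * W) * fps_deriv (fps_deriv G) = 0"
        unfolding fps_of_poly_mult fps_of_poly_diff fps_of_poly_power fps_of_poly_numeral
          dQ W X Q_def[symmetric]
        using F' G' G'' by algebra
    qed
    ultimately show ?thesis ..
  qed
qed

end
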